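(* Let $n$ be a positive integer, let $G_1,\ldots,G_n$ be an arbitrary sequence of finite graphs, and let $\mathbf{G} := G_1\square\cdots\square G_n$. For every $\emptyset\neq A\subseteq V(\mathbf{G})$, $$e_{\mathbf{G}}(A,A^c)\ge |A|\cdot\min\left\{\sum_{i=1}^n\psi_{G_i}(h_i) : 0\le h_i\le\log|V(G_i)| \text{ for all } i, \text{ and } \sum_{i=1}^n h_i=\log|A|\right\}.$$ In particular, if $G_1=\cdots=G_n=G$, then $$e_{\mathbf{G}}(A,A^c)\ge |A|\cdot n\cdot\psi_G\bigl((\log|A|)/n\bigr).$$
   Context: $\log$ is the natural logarithm and $[m]$ denotes $\{1,\dots,m\}$. For a graph $G$ and $A\subseteq V(G)$, $A^c = V(G)\setminus A$ and $e_G(A,A^c)$ is the number of edges of $G$ with exactly one endpoint in $A$. For an $m$-vertex graph $G$ and $k\in[m]$, $i_k(G) := \min\{e_G(A,A^c)/|A| : A\subseteq V(G),\ |A|=k\}$. The function $\psi_G\colon[0,\log m]\to[0,\infty)$ is the convex minorant of the points $(\log k, i_k(G))$, i.e. the largest convex function on $[0,\log m]$ satisfying $\psi_G(\log k)\le i_k(G)$ for all $k\in[m]$. The product graph $G_1\square\cdots\square G_n$ has vertex set $V(G_1)\times\cdots\times V(G_n)$, and its edges are all pairs $\{u,v\}$ for which there is an index $j\in[n]$ such that $u_jv_j\in E(G_j)$ and $u_l=v_l$ for all $l\neq j$. *)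

theory Defs
  imports "HOL-Analysis.Analysis"
begin

record 'a ugraph =
  vertices :: "'a set"
  edges :: "'a set set"

definition finite_graph :: "'a ugraph \<Rightarrow> bool" where
  "finite_graph G \<longleftrightarrow>
     finite (vertices G) \<and>
     edges G \<subseteq> {{u, v} | u v. u \<in> vertices G \<and> v \<in> vertices G \<and> u \<noteq> v}"

text \<open>Every edge is a two-element set, so \<open>card (e \<inter> A) = 1\<close> says that exactly one endpoint of
  \<open>e\<close> lies in \<open>A\<close>.\<close>

definition edge_boundary :: "'a ugraph \<Rightarrow> 'a set \<Rightarrow> nat" where
  "edge_boundary G A = card {e \<in> edges G. card (e \<inter> A) = 1}"

definition iso_const :: "'a ugraph \<Rightarrow> nat \<Rightarrow> real" where
  "iso_const G k =
     Min {real (edge_boundary G A) / real (card A) | A. A \<subseteq> vertices G \<and> card A = k}"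

definition convex_minorant :: "'a ugraph \<Rightarrow> (real \<Rightarrow> real) \<Rightarrow> bool" where
  "convex_minorant G g \<longleftrightarrow>
     convex_on {0..ln (real (card (vertices G)))} g \<and>
     (\<forall>k\<in>{1..card (vertices G)}. g (ln (real k)) \<le> iso_const G k)"

text \<open>The largest convex minorant is the pointwise supremum of all convex minorants. Only its
  values on \<open>[0, log m]\<close> are meaningful; that it is the largest convex minorant there is
  proved below.\<close>

definition \<psi> :: "'a ugraph \<Rightarrow> real \<Rightarrow> real" where
  "\<psi> G x = Sup {g x | g. convex_minorant G g}"

text \<open>Vertices of the product are functions on the index set \<open>{1..n}\<close>, extended by
  \<open>undefined\<close> outside it.\<close>

definition box_product :: "nat \<Rightarrow> (nat \<Rightarrow> 'a ugraph) \<Rightarrow> (nat \<Rightarrow> 'a) ugraph" where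
  "box_product n G = \<lparr>
     vertices = (\<Pi>\<^sub>E i\<in>{1..n}. vertices (G i)),
     edges = {{u, v} | u v.
       u \<in> (\<Pi>\<^sub>E i\<in>{1..n}. vertices (G i)) \<and>
       v \<in> (\<Pi>\<^sub>E i\<in>{1..n}. vertices (G i)) \<and>
       (\<exists>j\<in>{1..n}. {u j, v j} \<in> edges (G j) \<and> (\<forall>l\<in>{1..n} - {j}. u l = v l))} \<rparr>"

definition feasible :: "nat \<Rightarrow> (nat \<Rightarrow> 'a ugraph) \<Rightarrow> real \<Rightarrow> (nat \<Rightarrow> real) \<Rightarrow> bool" where
  "feasible n G s h \<longleftrightarrow>
     (\<forall>i\<in>{1..n}. 0 \<le> h i \<and> h i \<le> ln (real (card (vertices (G i))))) \<and>
     (\<Sum>i=1..n. h i) = s"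

lemma finite_graph_box_product:
  assumes "\<And>i. i \<in> {1..n} \<Longrightarrow> finite_graph (G i)"
  shows "finite_graph (box_product n G)"
proof -
  have "u \<noteq> v" if j: "j \<in> {1..n}" and e: "{u j, v j} \<in> edges (G j)" for u v j
  proof
    assume "u = v"
    with e have "{u j} \<in> edges (G j)" by simp
    with assms[OF j] obtain a b where "{u j} = {a, b}" "a \<noteq> b"
      unfolding finite_graph_def by blast
    then show False by (metis insertI1 insert_commute singletonD)
  qed
  then show ?thesis
    using assms unfolding finite_graph_def box_product_def
    by (auto intro!: finite_PiE) blast
qed

lemma iso_const_nonneg:
  assumes "finite_graph G" "k \<in> {1..card (vertices G)}"
  shows "0 \<le> iso_const G k"
proof -
  let ?S = "{real (edge_boundary G A) / real (card A) | A. A \<subseteq> vertices G \<and> card A = k}"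
  have "?S = (\<lambda>A. real (edge_boundary G A) / real (card A)) ` {A \<in> Pow (vertices G). card A = k}"
    by auto
  moreover have "finite {A \<in> Pow (vertices G). card A = k}"
    using assms(1) by (simp add: finite_graph_def)
  ultimately have "finite ?S" by simp
  moreover obtain A where "A \<subseteq> vertices G" "card A = k"
    using assms by (metis atLeastAtMost_iff obtain_subset_with_card_n)
  then have "?S \<noteq> {}" by blast
  ultimately show ?thesis
    unfolding iso_const_def by (subst Min_ge_iff) auto
qed

lemma convex_minorant_zero: "finite_graph G \<Longrightarrow> convex_minorant G (\<lambda>_. 0)"
  by (simp add: convex_minorant_def convex_on_def iso_const_nonneg)

lemma convex_minorant_le:
  assumes "convex_minorant G g" "x \<in> {0..ln (real (card (vertices G)))}" "vertices G \<noteq> {}"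
    "finite (vertices G)"
  shows "g x \<le> max (iso_const G 1) (iso_const G (card (vertices G)))"
proof -
  let ?m = "card (vertices G)"
  have m: "1 \<le> ?m" using assms by (simp add: Suc_leI card_gt_0_iff)
  have ends: "g 0 \<le> iso_const G 1" "g (ln (real ?m)) \<le> iso_const G ?m"
    using assms(1) m by (auto simp: convex_minorant_def dest: bspec[of _ _ 1] bspec[of _ _ ?m])
  have "convex_on {0..ln (real ?m)} g" using assms(1) by (simp add: convex_minorant_def)
  moreover have "x \<in> closed_segment 0 (ln (real ?m))"
    using assms(2) by (simp add: closed_segment_eq_real_ivl)
  then obtain t where t: "0 \<le> t" "t \<le> 1" "x = (1 - t) * 0 + t * ln (real ?m)"
    by (auto simp: closed_segment_def)
  ultimately have "g x \<le> (1 - t) * g 0 + t * g (ln (real ?m))"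
    using convex_onD[of "{0..ln (real ?m)}" g t 0 "ln (real ?m)"] m by simp
  also have "\<dots> \<le> max (g 0) (g (ln (real ?m)))"
    using t by (intro convex_bound_le) auto
  also have "\<dots> \<le> max (iso_const G 1) (iso_const G ?m)"
    using ends by auto
  finally show ?thesis .
qed

lemma convex_minorant_le_\<psi>:
  assumes "finite_graph G" "vertices G \<noteq> {}" "convex_minorant G g"
    "x \<in> {0..ln (real (card (vertices G)))}"
  shows "g x \<le> \<psi> G x"
  unfolding \<psi>_def
proof (rule cSup_upper)
  show "bdd_above {g x | g. convex_minorant G g}"
    using assms by (auto intro!: bdd_aboveI convex_minorant_le simp: finite_graph_def)
qed (use assms in blast)

lemma \<psi>_nonneg:
  assumes "finite_graph G" "vertices G \<noteq> {}" "x \<in> {0..ln (real (card (vertices G)))}"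
  shows "0 \<le> \<psi> G x"
  using convex_minorant_le_\<psi>[OF assms(1,2) convex_minorant_zero[OF assms(1)] assms(3)] .

lemma \<psi>_least:
  assumes "finite_graph G" "\<And>g. convex_minorant G g \<Longrightarrow> g x \<le> c"
  shows "\<psi> G x \<le> c"
  unfolding \<psi>_def
  by (rule cSup_least) (use assms convex_minorant_zero in blast)+

lemma convex_minorant_\<psi>:
  assumes "finite_graph G" "vertices G \<noteq> {}"
  shows "convex_minorant G (\<psi> G)"
proof -
  let ?I = "{0..ln (real (card (vertices G)))}"
  have "convex_on ?I (\<psi> G)"
    unfolding convex_on_def
  proof (intro conjI ballI allI impI)
    fix x y u v :: real
    assume *: "x \<in> ?I" "y \<in> ?I" "0 \<le> u" "0 \<le> v" "u + v = 1"
    show "\<psi> G (u *\<^sub>R x + v *\<^sub>R y) \<le> u * \<psi> G x + v * \<psi> G y"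
    proof (rule \<psi>_least[OF assms(1)])
      fix g assume g: "convex_minorant G g"
      then have "g (u *\<^sub>R x + v *\<^sub>R y) \<le> u * g x + v * g y"
        using * unfolding convex_minorant_def convex_on_def by blast
      also have "\<dots> \<le> u * \<psi> G x + v * \<psi> G y"
        using * g assms by (intro add_mono mult_left_mono convex_minorant_le_\<psi>) auto
      finally show "g (u *\<^sub>R x + v *\<^sub>R y) \<le> u * \<psi> G x + v * \<psi> G y" .
    qed
  qed simp
  moreover have "\<psi> G (ln (real k)) \<le> iso_const G k" if "k \<in> {1..card (vertices G)}" for k
    using that by (intro \<psi>_least[OF assms(1)]) (auto simp: convex_minorant_def)
  ultimately show ?thesis by (simp add: convex_minorant_def)
qed

end

theory Submission
  imports Defs
begin

text \<open>Let \<open>X\<close> be uniform on \<open>A\<close>. Splitting the boundary according to the direction \<open>j\<close> of an edge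
  and \<open>A\<close> into its fibres in direction \<open>j\<close>, Jensen's inequality bounds the boundary in direction \<open>j\<close>
  from below by \<open>|A| \<psi>\<^sub>j(h\<^sub>j)\<close>, where \<open>h\<^sub>j\<close> is the conditional entropy of \<open>X\<^sub>j\<close> given the other
  coordinates. By Han's inequality these entropies add up to at most the entropy \<open>log |A|\<close> of
  \<open>X\<close>, and since \<open>\<psi>\<^sub>j\<close> is decreasing they may be enlarged until equality holds.\<close>

section \<open>Han's inequality for fibre sizes\<close>

text \<open>The condition ranges over all \<open>l\<close>, not over an index set. For vertices of
  the product this changes nothing, since they agree outside \<open>{1..n}\<close>, and it lets the
  induction below shrink the set of directions while the fibres stay the same.\<close>

definition coord_fiber :: "'i \<Rightarrow> ('i \<Rightarrow> 'a) set \<Rightarrow> ('i \<Rightarrow> 'a) \<Rightarrow> ('i \<Rightarrow> 'a) set" where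
  "coord_fiber j A x = {y \<in> A. \<forall>l. l \<noteq> j \<longrightarrow> y l = x l}"

lemma finite_coord_fiber: "finite A \<Longrightarrow> finite (coord_fiber j A x)"
  by (simp add: coord_fiber_def)

lemma coord_fiber_self: "x \<in> A \<Longrightarrow> x \<in> coord_fiber j A x"
  by (simp add: coord_fiber_def)

lemma coord_fiber_eq: "y \<in> coord_fiber j A x \<Longrightarrow> coord_fiber j A y = coord_fiber j A x"
  by (auto simp: coord_fiber_def)

lemma card_coord_fiber_pos: "finite A \<Longrightarrow> x \<in> A \<Longrightarrow> 0 < card (coord_fiber j A x)"
  using coord_fiber_self[of x A j] finite_coord_fiber[of A j x] by (auto simp: card_gt_0_iff)

text \<open>The fibres in direction \<open>j\<close> partition \<open>A\<close>, and replacing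
  \<open>r\<close> by its mean on each fibre preserves the total. This turns bounds for fibre means
  into bounds for sums over \<open>A\<close>.\<close>

lemma sum_coord_fiber_average:
  fixes r :: "('i \<Rightarrow> 'a) \<Rightarrow> real"
  assumes "finite A"
  shows "(\<Sum>x\<in>A. (\<Sum>y\<in>coord_fiber j A x. r y) / real (card (coord_fiber j A x))) = sum r A"
proof -
  let ?d = "\<lambda>x. real (card (coord_fiber j A x))"
  have "(\<Sum>x\<in>A. (\<Sum>y\<in>coord_fiber j A x. r y) / ?d x)
      = (\<Sum>x\<in>A. \<Sum>y\<in>{y \<in> A. y \<in> coord_fiber j A x}. r y / ?d y)"
    by (intro sum.cong) (auto simp: sum_divide_distrib coord_fiber_eq coord_fiber_def
        intro!: sum.cong arg_cong[where f = card])
  also have "\<dots> = (\<Sum>y\<in>A. \<Sum>x\<in>{x \<in> A. y \<in> coord_fiber j A x}. r y / ?d y)"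
    using assms assms by (rule sum.swap_restrict)
  also have "\<dots> = (\<Sum>y\<in>A. \<Sum>x\<in>coord_fiber j A y. r y / ?d y)"
    by (intro sum.cong) (auto simp: coord_fiber_def)
  also have "\<dots> = sum r A"
    using card_coord_fiber_pos[OF assms] by (intro sum.cong) auto
  finally show ?thesis .
qed

text \<open>The sum counts triples \<open>(x, y, z)\<close>. The pair \<open>(y, z)\<close>
  determines \<open>x\<close>: all coordinates but \<open>k\<close> come from \<open>y\<close>, and
  coordinate \<open>k\<close> comes from \<open>z\<close>.\<close>

lemma sum_card_coord_fiber_mult_card_slice:
  fixes A :: "('i \<Rightarrow> 'a) set"
  assumes "finite A"
  shows "(\<Sum>x\<in>A. card (coord_fiber k A x) * card {z \<in> A. z k = x k}) \<le> card A * card A"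
proof -
  let ?T = "SIGMA x:A. coord_fiber k A x \<times> {z \<in> A. z k = x k}"
  have "(\<Sum>x\<in>A. card (coord_fiber k A x) * card {z \<in> A. z k = x k}) = card ?T"
    using assms by (simp add: finite_coord_fiber card_cartesian_product)
  also have "\<dots> \<le> card (A \<times> A)"
  proof (rule card_inj_on_le)
    have "x = y(k := z k)" if "y \<in> coord_fiber k A x" "z k = x k" for x y z :: "'i \<Rightarrow> 'a"
      using that by (auto simp: coord_fiber_def fun_eq_iff)
    then show "inj_on snd ?T"
      by (auto simp: inj_on_def) metis
    show "snd ` ?T \<subseteq> A \<times> A"
      by (auto simp: coord_fiber_def)
    show "finite (A \<times> A)" using assms by simp
  qed
  finally show ?thesis by (simp add: card_cartesian_product)
qed

text \<open>For uniform \<open>X\<close> on \<open>A\<close>, the means of the two logarithms are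
  the entropy of \<open>X k\<close> given the other coordinates and the entropy of \<open>X\<close>
  given \<open>X k\<close>. That they add up to at most \<open>ln (card A)\<close> follows from
  \<open>ln t \<le> t - 1\<close> at t = (fibre size)(slice size)/|A|, whose mean is at most 1 by
  the preceding count.\<close>

lemma sum_ln_card_coord_fiber_le_one:
  fixes A :: "('i \<Rightarrow> 'a) set"
  assumes "finite A"
  shows "(\<Sum>x\<in>A. ln (real (card (coord_fiber k A x))) + ln (real (card {z \<in> A. z k = x k})))
    \<le> real (card A) * ln (real (card A))"
proof (cases "A = {}")
  case False
  let ?d = "\<lambda>x. real (card (coord_fiber k A x))"
  let ?s = "\<lambda>x. real (card {z \<in> A. z k = x k})"
  let ?N = "real (card A)"
  have N: "?N > 0" using False assms by (simp add: card_gt_0_iff)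
  have le: "ln (?d x) + ln (?s x) \<le> ln ?N + (?d x * ?s x / ?N - 1)" if "x \<in> A" for x
  proof -
    have d: "?d x > 0" using card_coord_fiber_pos[OF assms that] by simp
    have s: "?s x > 0" using assms that by (auto simp: card_gt_0_iff)
    have "ln (?d x * ?s x / ?N) \<le> ?d x * ?s x / ?N - 1"
      using d s N by (intro ln_le_minus_one) simp
    then show ?thesis using d s N by (simp add: ln_div ln_mult)
  qed
  have "(\<Sum>x\<in>A. ln (?d x) + ln (?s x)) \<le> (\<Sum>x\<in>A. ln ?N + (?d x * ?s x / ?N - 1))"
    by (intro sum_mono le)
  also have "\<dots> = ?N * ln ?N + ((\<Sum>x\<in>A. ?d x * ?s x) / ?N - ?N)"
    by (simp add: sum.distrib sum_subtractf sum_divide_distrib)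
  also have "\<dots> \<le> ?N * ln ?N"
  proof -
    have "(\<Sum>x\<in>A. ?d x * ?s x)
        = real (\<Sum>x\<in>A. card (coord_fiber k A x) * card {z \<in> A. z k = x k})" by simp
    also have "\<dots> \<le> ?N * ?N"
      using sum_card_coord_fiber_mult_card_slice[OF assms, of k] of_nat_mono by fastforce
    finally show ?thesis using N by (simp add: divide_le_eq)
  qed
  finally show ?thesis .
qed simp

text \<open>Induction on the directions: fibres in directions other than \<open>k\<close> stay
  inside one slice \<open>z k = v\<close>, so the induction hypothesis applies slice by slice. The
  resulting log slice sizes are absorbed together with direction \<open>k\<close> by the
  one-coordinate bound.\<close>

theorem sum_ln_card_coord_fiber_le:
  fixes A :: "('i \<Rightarrow> 'a) set"
  assumes "finite I" "finite A"
  shows "(\<Sum>x\<in>A. \<Sum>j\<in>I. ln (real (card (coord_fiber j A x)))) \<le> real (card A) * ln (real (card A))"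
  using assms
proof (induction I arbitrary: A rule: finite_induct)
  case empty
  then show ?case by (cases "A = {}") (auto simp: Suc_leI card_gt_0_iff)
next
  case (insert k I)
  let ?slice = "\<lambda>v. {z \<in> A. z k = v}"
  have fib: "coord_fiber j A x = coord_fiber j (?slice (x k)) x" if "j \<in> I" for j x
    using that insert.hyps by (auto simp: coord_fiber_def)
  have split: "(\<Sum>x\<in>A. f x) = (\<Sum>v\<in>(\<lambda>x. x k) ` A. \<Sum>x\<in>?slice v. f x)" for f :: "_ \<Rightarrow> real"
    using insert.prems by (rule sum.image_gen)
  have "(\<Sum>x\<in>A. \<Sum>j\<in>I. ln (real (card (coord_fiber j A x))))
      = (\<Sum>v\<in>(\<lambda>x. x k) ` A. \<Sum>x\<in>?slice v. \<Sum>j\<in>I. ln (real (card (coord_fiber j (?slice v) x))))"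
    unfolding split by (intro sum.cong refl) (auto simp: fib)
  also have "\<dots> \<le> (\<Sum>v\<in>(\<lambda>x. x k) ` A. real (card (?slice v)) * ln (real (card (?slice v))))"
    using insert.prems by (intro sum_mono insert.IH) simp
  \<comment> \<open>The summand is constant on each slice, so the factor
    \<open>card (?slice v)\<close> is the sum over its elements.\<close>
  also have "\<dots> = (\<Sum>x\<in>A. ln (real (card (?slice (x k)))))"
    unfolding split by (intro sum.cong refl) simp
  finally have "(\<Sum>x\<in>A. \<Sum>j\<in>I. ln (real (card (coord_fiber j A x))))
      \<le> (\<Sum>x\<in>A. ln (real (card (?slice (x k)))))" .
  then show ?case
    using sum_ln_card_coord_fiber_le_one[OF insert.prems, of k] insert.hyps
    by (simp add: sum.distrib)
qed

section \<open>The convex minorant\<close>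

lemma finite_graph_edgeD:
  assumes "finite_graph G" "{u, v} \<in> edges G"
  shows "u \<in> vertices G" "v \<in> vertices G" "u \<noteq> v"
proof -
  obtain a b where "{u, v} = {a, b}" "a \<in> vertices G" "b \<in> vertices G" "a \<noteq> b"
    using assms unfolding finite_graph_def by blast
  then show "u \<in> vertices G" "v \<in> vertices G" "u \<noteq> v"
    by (auto simp: doubleton_eq_iff)
qed

lemma card_edge_Int_eq_1_iff:
  assumes "u \<noteq> v"
  shows "card ({u, v} \<inter> A) = 1 \<longleftrightarrow> (u \<in> A \<longleftrightarrow> v \<notin> A)"
  using assms by (cases "u \<in> A"; cases "v \<in> A") auto

text \<open>A boundary edge has a unique orientation leaving \<open>A\<close>, so boundary edges
  correspond to pairs with first entry inside and second outside.\<close>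

lemma edge_boundary_eq_sum:
  assumes "finite_graph G" "A \<subseteq> vertices G"
  shows "edge_boundary G A = (\<Sum>u\<in>A. card {v. v \<notin> A \<and> {u, v} \<in> edges G})"
proof -
  let ?S = "SIGMA u:A. {v. v \<notin> A \<and> {u, v} \<in> edges G}"
  have fin: "finite A" "finite (vertices G)"
    using assms finite_subset by (auto simp: finite_graph_def)
  have "finite {v. v \<notin> A \<and> {u, v} \<in> edges G}" for u
    by (rule finite_subset[OF _ fin(2)]) (auto dest: finite_graph_edgeD[OF assms(1)])
  then have "(\<Sum>u\<in>A. card {v. v \<notin> A \<and> {u, v} \<in> edges G}) = card ?S"
    using fin by simp
  also have "\<dots> = card {e \<in> edges G. card (e \<inter> A) = 1}"
  proof (rule bij_betw_same_card[where f = "\<lambda>(u, v). {u, v}"], rule bij_betwI')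
    fix p q assume "p \<in> ?S" "q \<in> ?S"
    then show "((\<lambda>(u, v). {u, v}) p = (\<lambda>(u, v). {u, v}) q) = (p = q)"
      by (auto simp: doubleton_eq_iff)
  next
    fix p assume "p \<in> ?S"
    then obtain u v where "p = (u, v)" "u \<in> A" "v \<notin> A" "{u, v} \<in> edges G" by blast
    moreover from this have "u \<noteq> v" by blast
    ultimately show "(\<lambda>(u, v). {u, v}) p \<in> {e \<in> edges G. card (e \<inter> A) = 1}"
      using card_edge_Int_eq_1_iff[of u v A] by simp
  next
    fix e assume e: "e \<in> {e \<in> edges G. card (e \<inter> A) = 1}"
    then obtain u v where "e = {u, v}" "u \<noteq> v"
      using assms(1) unfolding finite_graph_def by blast
    then have "(u, v) \<in> ?S \<or> (v, u) \<in> ?S"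
      using e card_edge_Int_eq_1_iff[of u v A] by (auto simp: insert_commute)
    then show "\<exists>p\<in>?S. e = (\<lambda>(u, v). {u, v}) p"
      using \<open>e = {u, v}\<close> by (metis (no_types, lifting) case_prod_conv insert_commute)
  qed
  finally show ?thesis by (simp add: edge_boundary_def)
qed

lemma iso_const_card_le:
  assumes "finite_graph G" "F \<subseteq> vertices G"
  shows "iso_const G (card F) \<le> real (edge_boundary G F) / real (card F)"
proof -
  let ?S = "{real (edge_boundary G A) / real (card A) | A. A \<subseteq> vertices G \<and> card A = card F}"
  have "?S \<subseteq> (\<lambda>A. real (edge_boundary G A) / real (card A)) ` Pow (vertices G)" by auto
  then have "finite ?S"
    using assms(1) finite_subset by (fastforce simp: finite_graph_def)
  then show ?thesis unfolding iso_const_def using assms(2) by (intro Min_le) auto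
qed

lemma card_mult_\<psi>_le_edge_boundary:
  assumes "finite_graph G" "F \<subseteq> vertices G" "F \<noteq> {}"
  shows "real (card F) * \<psi> G (ln (real (card F))) \<le> real (edge_boundary G F)"
proof -
  have fin: "finite (vertices G)" using assms by (simp add: finite_graph_def)
  then have F: "0 < card F" "card F \<le> card (vertices G)"
    using assms finite_subset by (auto simp: card_gt_0_iff card_mono)
  then have "\<psi> G (ln (real (card F))) \<le> iso_const G (card F)"
    using convex_minorant_\<psi>[OF assms(1)] assms(2,3) by (force simp: convex_minorant_def)
  also have "\<dots> \<le> real (edge_boundary G F) / real (card F)"
    by (rule iso_const_card_le) fact+
  finally show ?thesis using F by (simp add: field_simps)
qed

section \<open>Monotonicity and continuity of \<open>\<psi>\<close>\<close>

lemma ln_card_vertices_nonneg: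
  "finite_graph G \<Longrightarrow> vertices G \<noteq> {} \<Longrightarrow> 0 \<le> ln (real (card (vertices G)))"
  by (simp add: finite_graph_def Suc_leI card_gt_0_iff)

text \<open>The full vertex set has empty boundary, which forces the nonnegative function
  \<open>\<psi> G\<close> down to zero.\<close>

lemma \<psi>_right_end:
  assumes "finite_graph G" "vertices G \<noteq> {}"
  shows "\<psi> G (ln (real (card (vertices G)))) = 0"
proof -
  have empty: "{v. v \<notin> vertices G \<and> {u, v} \<in> edges G} = {}" for u
    using finite_graph_edgeD(2)[OF assms(1)] by blast
  have "edge_boundary G (vertices G) = 0"
    unfolding edge_boundary_eq_sum[OF assms(1) order_refl] empty by simp
  moreover have "0 < card (vertices G)" using assms by (simp add: finite_graph_def card_gt_0_iff)
  ultimately have "\<psi> G (ln (real (card (vertices G)))) \<le> 0"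
    using card_mult_\<psi>_le_edge_boundary[OF assms(1) order_refl assms(2)]
    by (simp add: mult_le_0_iff)
  with \<psi>_nonneg[OF assms, of "ln (real (card (vertices G)))"] show ?thesis
    using ln_card_vertices_nonneg[OF assms] by simp
qed

lemma \<psi>_convex:
  assumes "finite_graph G" "vertices G \<noteq> {}"
  shows "convex_on {0..ln (real (card (vertices G)))} (\<psi> G)"
  using convex_minorant_\<psi>[OF assms] by (simp add: convex_minorant_def)

text \<open>The point \<open>y\<close> lies between \<open>x\<close> and the right end, where
  \<open>\<psi> G\<close> vanishes; convexity and nonnegativity then give the bound.\<close>

lemma \<psi>_antimono:
  assumes G: "finite_graph G" "vertices G \<noteq> {}"
    and "0 \<le> x" "x \<le> y" "y \<le> ln (real (card (vertices G)))"
  shows "\<psi> G y \<le> \<psi> G x"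
proof -
  let ?M = "ln (real (card (vertices G)))"
  have "y \<in> closed_segment x ?M" using assms by (simp add: closed_segment_eq_real_ivl)
  then obtain t where t: "0 \<le> t" "t \<le> 1" "y = (1 - t) * x + t * ?M"
    by (auto simp: closed_segment_def)
  then have "\<psi> G y \<le> (1 - t) * \<psi> G x + t * \<psi> G ?M"
    using convex_onD[OF \<psi>_convex[OF G], of t x ?M] assms by simp
  also have "\<dots> \<le> 1 * \<psi> G x"
    using t assms(3-5) \<psi>_nonneg[OF G, of x] unfolding \<psi>_right_end[OF G]
    by (simp add: mult_left_le_one_le)
  finally show ?thesis by simp
qed

text \<open>The line through \<open>(0, i\<^sub>1)\<close> and \<open>(log 2, 0)\<close> is a convex minorant.\<close>

lemma \<psi>_ge_line:
  assumes G: "finite_graph G" "vertices G \<noteq> {}"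
    and x: "x \<in> {0..ln (real (card (vertices G)))}"
  shows "\<psi> G 0 - iso_const G 1 / ln 2 * x \<le> \<psi> G x"
proof -
  let ?c = "iso_const G 1"
  let ?g = "\<lambda>x. ?c - ?c / ln 2 * x"
  have m: "1 \<in> {1..card (vertices G)}" using G by (simp add: finite_graph_def Suc_leI card_gt_0_iff)
  have c: "0 \<le> ?c" by (rule iso_const_nonneg[OF G(1) m])
  have "?g (ln (real k)) \<le> iso_const G k" if k: "k \<in> {1..card (vertices G)}" for k
  \<comment> \<open>At \<open>k = 1\<close> the line takes the value \<open>iso_const G 1\<close>;
    from \<open>k = 2\<close> on it is at most 0.\<close>
  proof (cases "k = 1")
    case False
    with k have "ln 2 \<le> ln (real k)" by simp
    then have "?c * ln 2 \<le> ?c * ln (real k)" using c by (rule mult_left_mono)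
    then have "?g (ln (real k)) \<le> 0" by (simp add: field_simps)
    also have "0 \<le> iso_const G k" by (rule iso_const_nonneg[OF G(1) k])
    finally show ?thesis .
  qed simp
  moreover have "convex_on {0..ln (real (card (vertices G)))} ?g"
  proof (rule convex_onI)
    fix t x y :: real
    show "?g ((1 - t) *\<^sub>R x + t *\<^sub>R y) \<le> (1 - t) * ?g x + t * ?g y"
      by (simp add: algebra_simps add_divide_distrib diff_divide_distrib)
  qed simp
  ultimately have "convex_minorant G ?g" by (simp add: convex_minorant_def)
  then have "?g x \<le> \<psi> G x" using x by (intro convex_minorant_le_\<psi> G)
  moreover have "\<psi> G 0 \<le> ?c"
    using convex_minorant_\<psi>[OF G] m by (auto simp: convex_minorant_def dest: bspec[of _ _ 1])
  ultimately show ?thesis by linarith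
qed

text \<open>By convexity the slopes of \<open>\<psi>\<close> are smallest at \<open>0\<close>, so the bound there is a global
  Lipschitz bound.\<close>

lemma \<psi>_continuous_on:
  assumes G: "finite_graph G" "vertices G \<noteq> {}"
  shows "continuous_on {0..ln (real (card (vertices G)))} (\<psi> G)"
proof -
  let ?M = "ln (real (card (vertices G)))"
  define C where "C = iso_const G 1 / ln 2"
  have "1 \<in> {1..card (vertices G)}" using G by (simp add: finite_graph_def Suc_leI card_gt_0_iff)
  then have C: "0 \<le> C" unfolding C_def using iso_const_nonneg[OF G(1)] by simp
  have le: "\<psi> G x - \<psi> G y \<le> C * (y - x)" if xy: "0 \<le> x" "x < y" "y \<le> ?M" for x y
  proof (cases "x = 0")
    case True
    then show ?thesis using \<psi>_ge_line[OF G, of y] xy by (simp add: C_def)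
  next
    case False
    \<comment> \<open>With this \<open>t\<close>, the point \<open>x\<close> is a convex combination
      of 0 and \<open>y\<close>. The line bound then trades \<open>\<psi> G 0\<close> for
      \<open>\<psi> G x + C * x\<close>, and \<open>t * y = x\<close> turns (1 - t) x into t (y -
      x).\<close>
    define t where "t = x / y"
    have t: "0 < t" "t < 1" "t * y = x" using xy False by (auto simp: t_def)
    have "\<psi> G x \<le> (1 - t) * \<psi> G 0 + t * \<psi> G y"
      using convex_onD[OF \<psi>_convex[OF G], of t 0 y] xy t by simp
    also have "\<dots> \<le> (1 - t) * (\<psi> G x + C * x) + t * \<psi> G y"
      using \<psi>_ge_line[OF G, of x] xy t by (intro add_right_mono mult_left_mono) (auto simp: C_def)
    finally have "t * (\<psi> G x - \<psi> G y) \<le> (1 - t) * (C * x)" by (simp add: algebra_simps)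
    also have "\<dots> = t * (C * (y - x))"
      unfolding t(3)[symmetric] by (simp add: algebra_simps)
    finally show ?thesis using t by simp
  qed
  \<comment> \<open>Antitonicity fixes the sign of the difference, so the one-sided estimate bounds
    the distance.\<close>
  have "dist (\<psi> G x) (\<psi> G y) \<le> C * dist x y" if "x < y" "x \<in> {0..?M}" "y \<in> {0..?M}" for x y
    using le[of x y] \<psi>_antimono[OF G, of x y] that by (simp add: dist_real_def)
  then have "C-lipschitz_on {0..?M} (\<psi> G)"
    using C by (intro lipschitz_onI) (metis dist_commute dist_self linorder_neqE_linordered_idom mult_zero_right order_refl)
  then show ?thesis by (rule lipschitz_on_continuous_on)
qed

section \<open>Boundaries in the product graph\<close>

text \<open>For \<open>u\<close> in \<open>A\<close>, this is the number of boundary edges at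
  \<open>u\<close> in direction \<open>j\<close>. Recording a neighbour by its new coordinate
  \<open>b\<close> makes the count readable both in the product and in the factor
  \<open>G j\<close>.\<close>

definition dir_degree :: "(nat \<Rightarrow> 'a ugraph) \<Rightarrow> (nat \<Rightarrow> 'a) set \<Rightarrow> nat \<Rightarrow> (nat \<Rightarrow> 'a) \<Rightarrow> nat" where
  "dir_degree G A j u = card {b. u(j := b) \<notin> A \<and> {u j, b} \<in> edges (G j)}"

text \<open>Changing one coordinate of \<open>u\<close> so as to leave \<open>A\<close> gives a
  neighbour across the boundary, and this neighbour determines both the direction and the new
  value.\<close>

lemma sum_dir_degree_le_edge_boundary:
  assumes fg: "\<And>i. i \<in> {1..n} \<Longrightarrow> finite_graph (G i)"
    and A: "A \<subseteq> vertices (box_product n G)"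
  shows "(\<Sum>j=1..n. \<Sum>u\<in>A. dir_degree G A j u) \<le> edge_boundary (box_product n G) A"
proof -
  let ?P = "box_product n G"
  have fP: "finite_graph ?P" by (rule finite_graph_box_product) (rule fg)
  have V: "vertices ?P = (\<Pi>\<^sub>E i\<in>{1..n}. vertices (G i))" by (simp add: box_product_def)
  have "(\<Sum>j=1..n. dir_degree G A j u) \<le> card {v. v \<notin> A \<and> {u, v} \<in> edges ?P}" if u: "u \<in> A" for u
  proof -
    let ?D = "\<lambda>j. {b. u(j := b) \<notin> A \<and> {u j, b} \<in> edges (G j)}"
    let ?N = "{v. v \<notin> A \<and> {u, v} \<in> edges ?P}"
    have uV: "u \<in> (\<Pi>\<^sub>E i\<in>{1..n}. vertices (G i))" using u A V by auto
    have finN: "finite ?N"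
      by (rule finite_subset[of _ "vertices ?P"])
        (use fP in \<open>auto dest: finite_graph_edgeD[OF fP] simp: finite_graph_def\<close>)
    have finD: "finite (?D j)" if "j \<in> {1..n}" for j
      by (rule finite_subset[of _ "vertices (G j)"])
        (use fg[OF that] in \<open>auto dest: finite_graph_edgeD[OF fg[OF that]] simp: finite_graph_def\<close>)
    have "(\<Sum>j=1..n. dir_degree G A j u) = card (SIGMA j:{1..n}. ?D j)"
      using finD by (simp add: dir_degree_def)
    also have "\<dots> \<le> card ?N"
    proof (rule card_inj_on_le[OF _ _ finN])
      have ne: "b \<noteq> u j" if "u(j := b) \<notin> A" for j b
        using that u by auto
      show "inj_on (\<lambda>(j, b). u(j := b)) (SIGMA j:{1..n}. ?D j)"
      proof (rule inj_onI)
        fix p q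
        assume "p \<in> (SIGMA j:{1..n}. ?D j)" "q \<in> (SIGMA j:{1..n}. ?D j)"
          and pq: "(case p of (j, b) \<Rightarrow> u(j := b)) = (case q of (j, b) \<Rightarrow> u(j := b))"
        then obtain i a j b where p: "p = (i, a)" "u(i := a) \<notin> A" and q: "q = (j, b)" by blast
        have eq: "u(i := a) = u(j := b)" using pq p q by simp
        \<comment> \<open>Otherwise coordinate \<open>i\<close> of the right side is
          \<open>u i\<close>, so \<open>a = u i\<close>, against
          \<open>u(i := a) \<notin> A\<close>.\<close>
        have "i = j"
          using fun_cong[OF eq, of i] ne[OF p(2)] by (auto split: if_splits)
        then show "p = q" using fun_cong[OF eq, of i] p q by simp
      qed
      show "(\<lambda>(j, b). u(j := b)) ` (SIGMA j:{1..n}. ?D j) \<subseteq> ?N"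
      proof
        fix v assume "v \<in> (\<lambda>(j, b). u(j := b)) ` (SIGMA j:{1..n}. ?D j)"
        then obtain j b where v: "v = u(j := b)"
          and j: "j \<in> {1..n}" and b: "u(j := b) \<notin> A" "{u j, b} \<in> edges (G j)" by auto
        have "b \<in> vertices (G j)" using finite_graph_edgeD[OF fg[OF j] b(2)] by simp
        then have "u(j := b) \<in> (\<Pi>\<^sub>E i\<in>{1..n}. vertices (G i))"
          using uV j by (auto simp: PiE_iff extensional_def)
        moreover have "\<exists>i\<in>{1..n}. {u i, (u(j := b)) i} \<in> edges (G i) \<and>
            (\<forall>l\<in>{1..n} - {i}. u l = (u(j := b)) l)"
          using j b by (intro bexI[of _ j]) auto
        ultimately have "{u, u(j := b)} \<in> edges ?P"
          using uV unfolding box_product_def by (simp only: ugraph.simps) blast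
        then show "v \<in> ?N" using b v by simp
      qed
    qed
    finally show ?thesis .
  qed
  then have "(\<Sum>u\<in>A. \<Sum>j=1..n. dir_degree G A j u) \<le> edge_boundary ?P A"
    unfolding edge_boundary_eq_sum[OF fP A] by (rule sum_mono)
  then show ?thesis by (subst sum.swap)
qed

lemma card_coord_fiber_eq:
  "card {a. x(j := a) \<in> A} = card (coord_fiber j A x)"
proof (rule bij_betw_same_card[where f = "\<lambda>a. x(j := a)"], rule bij_betwI')
  fix y assume "y \<in> coord_fiber j A x"
  then show "\<exists>a\<in>{a. x(j := a) \<in> A}. y = x(j := a)"
    by (intro bexI[of _ "y j"]) (auto simp: coord_fiber_def fun_upd_def fun_eq_iff
        intro: back_subst[of "\<lambda>z. z \<in> A" y])
qed (auto simp: coord_fiber_def dest: fun_cong[of _ _ j])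

text \<open>Points \<open>y\<close> of the fibre differ from \<open>x\<close> only at
  \<open>j\<close>, so \<open>y(j := b) = x(j := b)\<close>: leaving \<open>A\<close> in direction
  \<open>j\<close> means leaving the projected fibre.\<close>

lemma edge_boundary_coord_fiber:
  assumes "finite_graph (G j)" "{a. x(j := a) \<in> A} \<subseteq> vertices (G j)"
  shows "edge_boundary (G j) {a. x(j := a) \<in> A} = (\<Sum>y\<in>coord_fiber j A x. dir_degree G A j y)"
  unfolding edge_boundary_eq_sum[OF assms]
proof (rule sum.reindex_bij_witness[where j = "\<lambda>a. x(j := a)" and i = "\<lambda>y. y j"])
  fix y assume y: "y \<in> coord_fiber j A x"
  then show "x(j := y j) = y" by (auto simp: coord_fiber_def)
  with y show "y j \<in> {a. x(j := a) \<in> A}" by (simp add: coord_fiber_def)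
qed (auto simp: coord_fiber_def dir_degree_def)

text \<open>The isoperimetric bound in \<open>G j\<close>, applied to the projected fibre through
  \<open>x\<close>, bounds the mean of \<open>dir_degree\<close> on that fibre from below. Summing
  over \<open>x\<close> and undoing the averaging gives the claim.\<close>

lemma sum_\<psi>_le_sum_dir_degree:
  assumes fg: "finite_graph (G j)"
    and fin: "finite A" and sub: "\<And>x a. x(j := a) \<in> A \<Longrightarrow> a \<in> vertices (G j)"
  shows "(\<Sum>x\<in>A. \<psi> (G j) (ln (real (card (coord_fiber j A x))))) \<le> (\<Sum>x\<in>A. real (dir_degree G A j x))"
proof -
  have "\<psi> (G j) (ln (real (card (coord_fiber j A x))))
      \<le> (\<Sum>y\<in>coord_fiber j A x. real (dir_degree G A j y)) / real (card (coord_fiber j A x))"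
    if x: "x \<in> A" for x
  proof -
    let ?F = "{a. x(j := a) \<in> A}"
    have F: "?F \<subseteq> vertices (G j)" using sub by auto
    moreover have "x j \<in> ?F" using x by simp
    then have "?F \<noteq> {}" by blast
    ultimately have "real (card ?F) * \<psi> (G j) (ln (real (card ?F))) \<le> real (edge_boundary (G j) ?F)"
      using fg by (intro card_mult_\<psi>_le_edge_boundary)
    then show ?thesis
      using card_coord_fiber_pos[OF fin x, of j]
      by (simp add: edge_boundary_coord_fiber[where G = G, OF fg F] card_coord_fiber_eq field_simps)
  qed
  then have "(\<Sum>x\<in>A. \<psi> (G j) (ln (real (card (coord_fiber j A x)))))
      \<le> (\<Sum>x\<in>A. (\<Sum>y\<in>coord_fiber j A x. real (dir_degree G A j y)) / real (card (coord_fiber j A x)))"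
    by (rule sum_mono)
  then show ?thesis unfolding sum_coord_fiber_average[OF fin] .
qed

section \<open>The optimisation problem\<close>

text \<open>Along the segment from \<open>h\<close> to \<open>M\<close> every coordinate grows and
  the sum moves affinely through all values in between.\<close>

lemma raise_to_sum:
  fixes h M :: "'i \<Rightarrow> real"
  assumes "finite I" "\<And>i. i \<in> I \<Longrightarrow> h i \<le> M i" "sum h I \<le> s" "s \<le> sum M I"
  obtains h' where "\<And>i. i \<in> I \<Longrightarrow> h i \<le> h' i \<and> h' i \<le> M i" "sum h' I = s"
proof -
  have "s \<in> closed_segment (sum h I) (sum M I)"
    using assms by (simp add: closed_segment_eq_real_ivl)
  then obtain t where t: "0 \<le> t" "t \<le> 1" "s = (1 - t) * sum h I + t * sum M I"
    by (auto simp: closed_segment_def)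
  let ?h = "\<lambda>i. (1 - t) * h i + t * M i"
  show thesis
  proof (rule that[of ?h])
    fix i assume i: "i \<in> I"
    have "0 \<le> t * (M i - h i)" "0 \<le> (1 - t) * (M i - h i)"
      using t assms(2)[OF i] by simp_all
    then show "h i \<le> ?h i \<and> ?h i \<le> M i" by (simp add: algebra_simps)
  next
    show "sum ?h I = s" using t by (simp add: sum.distrib sum_distrib_left)
  qed
qed

text \<open>A continuous objective attains its minimum on a compact set. As \<open>feasible\<close>
  leaves \<open>h\<close> free outside \<open>{1..n}\<close>, the compact set \<open>K\<close> sets
  those values to 0.\<close>

lemma feasible_arg_min_exists:
  assumes fg: "\<And>i. i \<in> {1..n} \<Longrightarrow> finite_graph (G i) \<and> vertices (G i) \<noteq> {}"
    and ex: "feasible n G s h0"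
  shows "\<exists>h. is_arg_min (\<lambda>h. \<Sum>i=1..n. \<psi> (G i) (h i)) (feasible n G s) h"
proof -
  let ?M = "\<lambda>i. ln (real (card (vertices (G i))))"
  let ?f = "\<lambda>h. \<Sum>i=1..n. \<psi> (G i) (h i)"
  let ?r = "\<lambda>h i. if i \<in> {1..n} then h i else (0::real)"
  define B where "B = (\<Pi>\<^sub>E i\<in>UNIV. if i \<in> {1..n} then {0..?M i} else {0})"
  define K where "K = B \<inter> {h. (\<Sum>i=1..n. h i) = s}"
  have coord: "continuous_on X (\<lambda>h. h i)" for X :: "(nat \<Rightarrow> real) set" and i
    by (rule continuous_on_subset[OF continuous_on_product_coordinates]) simp
  have "compact B"
    \<comment> \<open>Tychonoff's theorem for a product of intervals and singletons.\<close>
    using compactin_PiE[of "\<lambda>_. euclidean" UNIV "\<lambda>i. if i \<in> {1..n} then {0..?M i} else {0}"]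
    by (simp add: B_def euclidean_product_topology)
  moreover have "closed {h :: nat \<Rightarrow> real. (\<Sum>i=1..n. h i) = s}"
    by (intro closed_Collect_eq continuous_on_sum coord continuous_on_const)
  ultimately have K: "compact K" unfolding K_def by (rule compact_Int_closed)
  have KI: "?r h \<in> K" if "feasible n G s h" for h
    using that by (auto simp: K_def B_def feasible_def)
  have KD: "feasible n G s h" if "h \<in> K" for h
  proof -
    have "h i \<in> (if i \<in> {1..n} then {0..?M i} else {0})" for i
      using that by (simp add: K_def B_def PiE_iff)
    then have "h i \<in> {0..?M i}" if "i \<in> {1..n}" for i
      using that by metis
    with that show ?thesis by (simp add: K_def feasible_def)
  qed
  have "continuous_on K ?f"
  proof (intro continuous_on_sum)
    fix i assume i: "i \<in> {1..n}"
    show "continuous_on K (\<lambda>h. \<psi> (G i) (h i))"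
      using i fg[OF i] KD
      by (intro continuous_on_compose2[OF \<psi>_continuous_on coord]) (auto simp: feasible_def)
  qed
  then obtain h where h: "h \<in> K" "\<And>y. y \<in> K \<Longrightarrow> ?f h \<le> ?f y"
    using continuous_attains_inf[OF K] KI[OF ex] by blast
  \<comment> \<open>Zeroing \<open>y\<close> outside \<open>{1..n}\<close> moves it into
    \<open>K\<close> and keeps the objective.\<close>
  have "?f h \<le> ?f y" if "feasible n G s y" for y
    using h(2)[OF KI[OF that]] by simp
  then show ?thesis using KD[OF h(1)] by (auto simp: is_arg_min_def not_less)
qed

section \<open>From fibre entropies to the edge-isoperimetric inequality\<close>

theorem theorem1:
  fixes n :: nat and G :: "nat \<Rightarrow> 'a ugraph" and A :: "(nat \<Rightarrow> 'a) set"
  assumes "n \<ge> 1"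
    and "\<forall>i\<in>{1..n}. finite_graph (G i)"
    and "A \<noteq> {}"
    and "A \<subseteq> vertices (box_product n G)"
  shows "(\<exists>h. is_arg_min (\<lambda>h. \<Sum>i=1..n. \<psi> (G i) (h i)) (feasible n G (ln (real (card A)))) h \<and>
            real (edge_boundary (box_product n G) A) \<ge>
              real (card A) * (\<Sum>i=1..n. \<psi> (G i) (h i)))
    \<and> (\<forall>H. (\<forall>i\<in>{1..n}. G i = H) \<longrightarrow>
            real (edge_boundary (box_product n G) A) \<ge>
              real (card A) * real n * \<psi> H (ln (real (card A)) / real n))"
proof -
  let ?M = "\<lambda>i. ln (real (card (vertices (G i))))"
  let ?f = "\<lambda>h. \<Sum>i=1..n. \<psi> (G i) (h i)"
  let ?N = "real (card A)"
  let ?e = "real (edge_boundary (box_product n G) A)"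
  have sub: "A \<subseteq> (\<Pi>\<^sub>E i\<in>{1..n}. vertices (G i))"
    using assms(4) by (simp add: box_product_def)
  have finP: "finite (\<Pi>\<^sub>E i\<in>{1..n}. vertices (G i))"
    using assms(2) by (intro finite_PiE) (auto simp: finite_graph_def)
  then have fin: "finite A" using sub finite_subset by blast
  then have N: "?N > 0" using assms(3) by (simp add: card_gt_0_iff)
  have fg: "finite_graph (G i)" "vertices (G i) \<noteq> {}" if "i \<in> {1..n}" for i
    using that assms(2,3) sub by (auto dest: PiE_mem)
  have inV: "a \<in> vertices (G i)" if "i \<in> {1..n}" "x(i := a) \<in> A" for i x a
    using that sub by (metis PiE_mem fun_upd_same subsetD)
  define d where "d i x = ln (real (card (coord_fiber i A x)))" for i x
  \<comment> \<open>The conditional entropy of coordinate \<open>i\<close> given the others, written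
    with weights \<open>1 / ?N\<close> to suit Jensen's inequality.\<close>
  define h' where "h' i = (\<Sum>x\<in>A. (1 / ?N) * d i x)" for i
  have d: "d i x \<in> {0..?M i}" if "i \<in> {1..n}" "x \<in> A" for i x
  proof -
    have "card (coord_fiber i A x) \<le> card (vertices (G i))"
      unfolding card_coord_fiber_eq[symmetric]
      using fg[OF that(1)] inV[OF that(1)] by (intro card_mono) (auto simp: finite_graph_def)
    then show ?thesis
      using card_coord_fiber_pos[OF fin that(2), of i] by (simp add: d_def Suc_leI)
  qed
  have h': "h' i \<in> {0..?M i}" if i: "i \<in> {1..n}" for i
    using convex_sum[OF fin convex_closed_interval, of "\<lambda>_. 1 / ?N" "d i" 0 "?M i"] N d[OF i]
    by (simp add: h'_def)
  have "?N * ?f h' \<le> ?e"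
  proof -
    have "?N * \<psi> (G i) (h' i) \<le> (\<Sum>u\<in>A. real (dir_degree G A i u))" if i: "i \<in> {1..n}" for i
    proof -
      have "\<psi> (G i) (h' i) \<le> (\<Sum>x\<in>A. (1 / ?N) * \<psi> (G i) (d i x))"
        unfolding h'_def
        using convex_on_sum[OF fin assms(3) \<psi>_convex[OF fg[OF i]], of "\<lambda>_. 1 / ?N" "d i"] N d[OF i]
        by simp
      then have "?N * \<psi> (G i) (h' i) \<le> (\<Sum>x\<in>A. \<psi> (G i) (d i x))"
        using N by (simp add: sum_distrib_left[symmetric] field_simps flip: sum_divide_distrib)
      also have "\<dots> \<le> (\<Sum>u\<in>A. real (dir_degree G A i u))"
        unfolding d_def using fg[OF i] inV[OF i] fin by (intro sum_\<psi>_le_sum_dir_degree)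
      finally show ?thesis .
    qed
    then have "?N * ?f h' \<le> (\<Sum>j=1..n. \<Sum>u\<in>A. real (dir_degree G A j u))"
      unfolding sum_distrib_left by (rule sum_mono)
    also have "\<dots> = real (\<Sum>j=1..n. \<Sum>u\<in>A. dir_degree G A j u)" by simp
    also have "\<dots> \<le> ?e"
      using sum_dir_degree_le_edge_boundary[OF fg(1) assms(4)] by (rule of_nat_mono)
    finally show ?thesis .
  qed
  moreover have "(\<Sum>i=1..n. h' i) \<le> ln ?N"
  proof -
    have "(\<Sum>i=1..n. h' i) = (\<Sum>x\<in>A. \<Sum>i=1..n. d i x) / ?N"
      unfolding h'_def by (subst sum.swap) (simp add: sum_divide_distrib)
    then show ?thesis
      using sum_ln_card_coord_fiber_le[OF finite_atLeastAtMost[of 1 n] fin] N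
      by (simp add: d_def divide_le_eq mult.commute)
  qed
  moreover have "ln ?N \<le> (\<Sum>i=1..n. ?M i)"
  proof -
    have "card A \<le> (\<Prod>i=1..n. card (vertices (G i)))"
      using card_mono[OF finP sub] by (simp add: card_PiE)
    then have "ln ?N \<le> ln (\<Prod>i=1..n. real (card (vertices (G i))))"
      using N by (simp add: ln_mono del: of_nat_prod flip: of_nat_prod)
    also have "\<dots> = (\<Sum>i=1..n. ?M i)"
      using fg by (intro ln_prod) (auto simp: finite_graph_def card_gt_0_iff)
    finally show ?thesis .
  qed
  ultimately obtain h where h: "\<And>i. i \<in> {1..n} \<Longrightarrow> h' i \<le> h i \<and> h i \<le> ?M i"
    "(\<Sum>i=1..n. h i) = ln ?N"
    using raise_to_sum[of "{1..n}" h' ?M "ln ?N"] h' by auto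
  have feas: "feasible n G (ln ?N) h"
    using h h' unfolding feasible_def by (meson atLeastAtMost_iff order_trans)
  \<comment> \<open>Raising the entropies to reach the sum \<open>ln ?N\<close> can only lower the
    objective.\<close>
  have "?f h \<le> ?f h'"
    using h h' fg by (intro sum_mono \<psi>_antimono) auto
  then have e: "?N * ?f h \<le> ?e"
    using \<open>?N * ?f h' \<le> ?e\<close> N by (meson mult_left_mono less_imp_le order_trans)
  obtain h\<^sub>0 where h\<^sub>0: "is_arg_min ?f (feasible n G (ln ?N)) h\<^sub>0"
    using feasible_arg_min_exists[OF _ feas] fg by blast
  then have "?f h\<^sub>0 \<le> ?f h" using feas by (auto simp: is_arg_min_def not_less)
  then have "?N * ?f h\<^sub>0 \<le> ?e" using e N by (meson mult_left_mono less_imp_le order_trans)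
  moreover have "?N * real n * \<psi> H (ln ?N / real n) \<le> ?e" if H: "\<forall>i\<in>{1..n}. G i = H" for H
  proof -
    have H1: "finite_graph H" "vertices H \<noteq> {}" using fg[of 1] H assms(1) by auto
    \<comment> \<open>Jensen with equal weights: the mean of the \<open>h i\<close> is
      \<open>ln ?N / real n\<close>, so the bound already proved at \<open>h\<close>
      suffices.\<close>
    have "\<psi> H (\<Sum>i=1..n. (1 / real n) * h i) \<le> (\<Sum>i=1..n. (1 / real n) * \<psi> H (h i))"
      using convex_on_sum[OF _ _ \<psi>_convex[OF H1], of "{1..n}" "\<lambda>_. 1 / real n" h] assms(1) feas H
      by (simp add: feasible_def)
    then have "real n * \<psi> H (ln ?N / real n) \<le> (\<Sum>i=1..n. \<psi> H (h i))"
      using assms(1) h(2)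
      by (simp add: field_simps flip: sum_divide_distrib)
    also have "\<dots> = ?f h" using H by simp
    finally have "?N * (real n * \<psi> H (ln ?N / real n)) \<le> ?N * ?f h"
      by (rule mult_left_mono) simp
    then show ?thesis using e by (simp add: mult.assoc)
  qed
  ultimately show ?thesis using h\<^sub>0 by blast
qed

end
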